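(* Let $E$ be a Banach lattice and let $\mathcal{T} = (T_t)_{t \in J}$ be a bounded semigroup of positive operators on $E$, where $J = \mathbb{N}$ or $J = (0,\infty)$. If there exists a lower bound $h \neq 0$ for $\mathcal{T}$, then there exists an equivalent norm $\|\cdot\|_1$ on $E$ such that $(E,\|\cdot\|_1)$ is an AL-space.
   Context: All spaces are real. $\mathbb{N} = \{1,2,\dots\}$. $E_+$ is the positive cone of $E$. An AL-space is a Banach lattice whose norm is additive on the positive cone, i.e. $\|f+g\| = \|f\|+\|g\|$ for all $f,g \ge 0$ (here $(E,\|\cdot\|_1)$ carries the same order as $E$). A semigroup on $E$ is a family $(T_t)_{t \in J}$ of bounded linear operators on $E$ with $T_{t+s} = T_tT_s$ for all $s,t \in J$; no continuity in $t$ is assumed. It is bounded if $\sup_{t\in J}\|T_t\|<\infty$. $T$ is positive if $TE_+\subseteq E_+$. A lower bound for a positive semigroup $\mathcal{T}$ is a vector $h \in E_+$ such that $\|(T_tf-h)^-\| \to 0$ as $t \to \infty$ for every $f \in E_+$ with $\|f\|=1$; here $g^- = (-g)\vee 0$. *)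

theory Defs
  imports "HOL-Analysis.Analysis" "HOL-Library.Lattice_Algebras"
begin

class vector_lattice = ordered_real_vector + lattice_ab_group_add_abs

class banach_lattice = banach + vector_lattice +
  assumes norm_le_of_abs_le: "\<bar>x\<bar> \<le> \<bar>y\<bar> \<Longrightarrow> norm x \<le> norm y"

instance real :: banach_lattice
  by standard simp

text \<open>The theorem is about a second norm on a given space, so norms are also treated as
  functions. Linear structure and order are always those of the type.\<close>

definition is_norm :: "('a::real_vector \<Rightarrow> real) \<Rightarrow> bool" where
  "is_norm p \<longleftrightarrow>
     (\<forall>x. 0 \<le> p x) \<and> (\<forall>x. p x = 0 \<longleftrightarrow> x = 0) \<and>
     (\<forall>a x. p (a *\<^sub>R x) = \<bar>a\<bar> * p x) \<and> (\<forall>x y. p (x + y) \<le> p x + p y)"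

definition complete_norm :: "('a::real_vector \<Rightarrow> real) \<Rightarrow> bool" where
  "complete_norm p \<longleftrightarrow>
     (\<forall>X :: nat \<Rightarrow> 'a. (\<forall>e>0. \<exists>M. \<forall>m\<ge>M. \<forall>n\<ge>M. p (X m - X n) < e) \<longrightarrow>
        (\<exists>L. (\<lambda>n. p (X n - L)) \<longlonglongrightarrow> 0))"

definition banach_lattice_norm :: "('a::vector_lattice \<Rightarrow> real) \<Rightarrow> bool" where
  "banach_lattice_norm p \<longleftrightarrow>
     is_norm p \<and> complete_norm p \<and> (\<forall>x y. \<bar>x\<bar> \<le> \<bar>y\<bar> \<longrightarrow> p x \<le> p y)"

definition AL_norm :: "('a::vector_lattice \<Rightarrow> real) \<Rightarrow> bool" where
  "AL_norm p \<longleftrightarrow>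
     banach_lattice_norm p \<and> (\<forall>f g. 0 \<le> f \<longrightarrow> 0 \<le> g \<longrightarrow> p (f + g) = p f + p g)"

definition equivalent_norms :: "('a \<Rightarrow> real) \<Rightarrow> ('a \<Rightarrow> real) \<Rightarrow> bool" where
  "equivalent_norms p q \<longleftrightarrow> (\<exists>c>0. \<exists>C>0. \<forall>x. c * p x \<le> q x \<and> q x \<le> C * p x)"

lemma banach_lattice_norm_norm: "banach_lattice_norm (norm :: 'a::banach_lattice \<Rightarrow> real)"
proof -
  have "\<exists>L. (\<lambda>n. norm (X n - L)) \<longlonglongrightarrow> 0"
    if "\<forall>e>0. \<exists>M. \<forall>m\<ge>M. \<forall>n\<ge>M. norm (X m - X n) < e" for X :: "nat \<Rightarrow> 'a"
  proof -
    have "Cauchy X"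
      using that by (simp add: Cauchy_iff)
    then obtain L where "X \<longlonglongrightarrow> L"
      by (auto simp: Cauchy_convergent_iff convergent_def)
    then show ?thesis
      by (auto simp: tendsto_norm_zero_iff LIM_zero_iff)
  qed
  then show ?thesis
    by (simp add: banach_lattice_norm_def is_norm_def complete_norm_def norm_triangle_ineq
        norm_le_of_abs_le)
qed

text \<open>Both time sets are subsets of the reals: \<^term>\<open>\<nat> - {0} :: real set\<close> and
  \<^term>\<open>{0<..} :: real set\<close>. A semigroup is a function on the reals of which only the values
  on the time set matter.\<close>

definition semigroup_on :: "real set \<Rightarrow> (real \<Rightarrow> 'a::real_normed_vector \<Rightarrow>\<^sub>L 'a) \<Rightarrow> bool" where
  "semigroup_on J T \<longleftrightarrow> (\<forall>t\<in>J. \<forall>s\<in>J. T (t + s) = T t o\<^sub>L T s)"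

definition positive_operator :: "('a::banach_lattice \<Rightarrow>\<^sub>L 'a) \<Rightarrow> bool" where
  "positive_operator S \<longleftrightarrow> (\<forall>f\<ge>0. 0 \<le> blinfun_apply S f)"

text \<open>The negative part is nonnegative, unlike \<^const>\<open>nprt\<close>, which is its additive inverse.\<close>

definition neg_part :: "'a::vector_lattice \<Rightarrow> 'a" where
  "neg_part g = sup (- g) 0"

definition lower_bound ::
  "real set \<Rightarrow> (real \<Rightarrow> 'a::banach_lattice \<Rightarrow>\<^sub>L 'a) \<Rightarrow> 'a \<Rightarrow> bool" where
  "lower_bound J T h \<longleftrightarrow> 0 \<le> h \<and>
     (\<forall>f\<ge>0. norm f = 1 \<longrightarrow>
       ((\<lambda>t. norm (neg_part (blinfun_apply (T t) f - h))) \<longlongrightarrow> 0) (inf at_top (principal J)))"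

end

theory Submission
  imports Defs
begin

text \<open>For \<open>x\<close> put \<open>p x = sup \<Sum>\<^sub>i \<parallel>f\<^sub>i\<parallel>\<close>, the supremum being over all finite families of positive
  vectors with \<open>\<Sum>\<^sub>i f\<^sub>i = \<bar>x\<bar>\<close>. On the positive cone \<open>p\<close> is additive wherever it is finite:
  families for \<open>f\<close> and \<open>g\<close> concatenate to one for \<open>f + g\<close>, and conversely, by the Riesz
  decomposition property, a family for \<open>f + g\<close> splits into families for \<open>f\<close> and \<open>g\<close> whose norm
  sums together are at least as large (\<open>riesz_split\<close>). So \<open>p\<close> is an equivalent AL-norm as
  soon as \<open>\<Sum>\<^sub>i \<parallel>f\<^sub>i\<parallel> \<le> K \<parallel>\<Sum>\<^sub>i f\<^sub>i\<parallel>\<close> for some constant \<open>K\<close> and all such families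
  (\<open>AL_renorming\<close>).

  The lower bound provides such a \<open>K\<close>. By scaling, \<open>T\<^sub>t f\<close> eventually dominates \<open>\<parallel>f\<parallel> h\<close> up to an
  error of vanishing norm, for every positive \<open>f\<close>. Adding these relations over a family,
  \<open>T\<^sub>t (\<Sum>\<^sub>i f\<^sub>i)\<close> dominates \<open>(\<Sum>\<^sub>i \<parallel>f\<^sub>i\<parallel>) h\<close> up to such an error. If \<open>M\<close> bounds the
  operators, the limit \<open>t \<rightarrow> \<infinity>\<close> gives \<open>(\<Sum>\<^sub>i \<parallel>f\<^sub>i\<parallel>) \<parallel>h\<parallel> \<le> M \<parallel>\<Sum>\<^sub>i f\<^sub>i\<parallel>\<close>, that is
  \<open>K = M / \<parallel>h\<parallel>\<close>.\<close>

section \<open>Vector lattices\<close>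

lemma abs_scaleR_le: "\<bar>a *\<^sub>R x\<bar> \<le> \<bar>a\<bar> *\<^sub>R \<bar>x\<bar>" for x :: "'a::vector_lattice"
proof -
  have nn: "b *\<^sub>R y \<le> b *\<^sub>R \<bar>y\<bar>" if "0 \<le> b" for b and y :: 'a
    using that by (intro scaleR_left_mono abs_ge_self)
  show ?thesis
  proof (cases "0 \<le> a")
    case True
    then show ?thesis
      using nn[of a x] nn[of a "- x"] by (intro abs_leI) auto
  next
    case False
    then show ?thesis
      using nn[of "- a" x] nn[of "- a" "- x"] by (intro abs_leI) auto
  qed
qed

lemma neg_part_nonneg: "0 \<le> neg_part x"
  by (simp add: neg_part_def)

lemma neg_part_add_le: "neg_part (x + y) \<le> neg_part x + neg_part y"
proof -
  have "- x + - y \<le> neg_part x + neg_part y"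
    by (intro add_mono) (simp_all add: neg_part_def)
  then show ?thesis
    unfolding neg_part_def[of "x + y"]
    by (intro le_supI add_nonneg_nonneg neg_part_nonneg) simp
qed

lemma neg_part_scaleR_le: "0 \<le> a \<Longrightarrow> neg_part (a *\<^sub>R x) \<le> a *\<^sub>R neg_part x"
proof -
  assume a: "0 \<le> a"
  have "a *\<^sub>R (- x) \<le> a *\<^sub>R neg_part x"
    by (intro scaleR_left_mono a) (simp add: neg_part_def)
  then show ?thesis
    unfolding neg_part_def[of "a *\<^sub>R x"]
    by (intro le_supI scaleR_nonneg_nonneg neg_part_nonneg a) simp
qed

lemma norm_mono_nonneg: "0 \<le> x \<Longrightarrow> x \<le> y \<Longrightarrow> norm x \<le> norm y" for x y :: "'a::banach_lattice"
  by (rule norm_le_of_abs_le) (simp add: abs_of_nonneg)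

lemma norm_abs: "norm \<bar>x\<bar> = norm x" for x :: "'a::banach_lattice"
  by (intro antisym norm_le_of_abs_le) simp_all

section \<open>Positive decompositions\<close>

text \<open>Families are lists, so that repeated summands count with their multiplicity.\<close>

definition decompositions :: "'a::vector_lattice \<Rightarrow> 'a list set" where
  "decompositions x = {fs. (\<forall>f\<in>set fs. 0 \<le> f) \<and> sum_list fs = \<bar>x\<bar>}"

definition norm_sum :: "'a::real_normed_vector list \<Rightarrow> real" where
  "norm_sum fs = (\<Sum>f\<leftarrow>fs. norm f)"

definition variation :: "'a::banach_lattice \<Rightarrow> real" where
  "variation x = (SUP fs\<in>decompositions x. norm_sum fs)"

lemma singleton_decomposition: "[\<bar>x\<bar>] \<in> decompositions x"
  by (simp add: decompositions_def)

lemma norm_sum_append: "norm_sum (fs @ gs) = norm_sum fs + norm_sum gs"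
  by (simp add: norm_sum_def)

lemma norm_sum_nonneg: "0 \<le> norm_sum fs"
  by (induction fs) (simp_all add: norm_sum_def)

lemma norm_sum_scaleR: "norm_sum (map ((*\<^sub>R) a) fs) = \<bar>a\<bar> * norm_sum fs"
  by (simp add: norm_sum_def sum_list_const_mult o_def)

lemma sum_list_scaleR: "sum_list (map ((*\<^sub>R) a) fs) = a *\<^sub>R sum_list fs"
  for fs :: "'a::real_vector list"
  by (induction fs) (simp_all add: scaleR_add_right)

text \<open>The Riesz decomposition property for several summands: the first summand \<open>a\<close> is cut into
  \<open>inf a f\<close> and the rest, which lies below \<open>g\<close>; the induction goes on with what is left of \<open>f\<close>
  and \<open>g\<close>. Cutting a summand does not decrease the sum of norms, by the triangle inequality.\<close>

lemma riesz_split: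
  fixes f g :: "'a::banach_lattice"
  assumes "0 \<le> f" "0 \<le> g" "\<forall>k\<in>set ks. 0 \<le> k" "sum_list ks = f + g"
  shows "\<exists>fs\<in>decompositions f. \<exists>gs\<in>decompositions g. norm_sum ks \<le> norm_sum fs + norm_sum gs"
  using assms
proof (induction ks arbitrary: f g)
  case Nil
  then have "f = 0" "g = 0"
    by (auto simp: add_nonneg_eq_0_iff)
  then have "[] \<in> decompositions f" "[] \<in> decompositions g"
    by (simp_all add: decompositions_def)
  then show ?case
    by (intro bexI[of _ "[]"]) (simp_all add: norm_sum_def)
next
  case (Cons a ks)
  define b where "b = inf a f"
  have b: "0 \<le> b" "b \<le> a" "b \<le> f"
    using Cons.prems by (auto simp: b_def)
  have "0 \<le> sum_list ks"
    using Cons.prems(3) by (intro sum_list_nonneg) auto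
  then have "a \<le> f + g"
    using Cons.prems(4) by (simp flip: Cons.prems(4))
  moreover have "a \<le> a + g"
    using Cons.prems(2) by simp
  ultimately have "a \<le> b + g"
    by (simp add: b_def add_inf_distrib_right)
  then have c: "a - b \<le> g"
    by (simp add: algebra_simps)
  have "sum_list ks = (f - b) + (g - (a - b))"
    using Cons.prems(4) by (simp add: algebra_simps)
  then obtain fs gs where
    fs: "fs \<in> decompositions (f - b)" and gs: "gs \<in> decompositions (g - (a - b))"
    and le: "norm_sum ks \<le> norm_sum fs + norm_sum gs"
    using Cons.IH[of "f - b" "g - (a - b)"] Cons.prems(3) b c by force
  have fs': "b # fs \<in> decompositions f"
    using fs b Cons.prems by (auto simp: decompositions_def abs_of_nonneg)
  have gs': "(a - b) # gs \<in> decompositions g"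
    using gs b c Cons.prems by (auto simp: decompositions_def abs_of_nonneg)
  have "norm_sum (a # ks) \<le> norm_sum (b # fs) + norm_sum ((a - b) # gs)"
    using le norm_triangle_ineq[of b "a - b"] by (simp add: norm_sum_def)
  with fs' gs' show ?case
    by blast
qed

section \<open>The renorming\<close>

context
  fixes K :: real
  assumes norm_sum_le:
    "\<And>fs :: 'a::banach_lattice list. \<forall>f\<in>set fs. 0 \<le> f \<Longrightarrow> norm_sum fs \<le> K * norm (sum_list fs)"
begin

private lemma norm_sum_le_norm: "fs \<in> decompositions x \<Longrightarrow> norm_sum fs \<le> K * norm x"
  for x :: 'a
  using norm_sum_le[of fs] by (simp add: decompositions_def norm_abs)

private lemma norm_sum_le_variation: "fs \<in> decompositions x \<Longrightarrow> norm_sum fs \<le> variation x"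
  for x :: 'a
  unfolding variation_def
  by (intro cSUP_upper bdd_aboveI2[where M = "K * norm x"] norm_sum_le_norm)

private lemma variation_least:
  "(\<And>fs. fs \<in> decompositions x \<Longrightarrow> norm_sum fs \<le> B) \<Longrightarrow> variation x \<le> B" for x :: 'a
  unfolding variation_def using singleton_decomposition by (intro cSUP_least) auto

private lemma norm_le_variation: "norm x \<le> variation x" for x :: 'a
  using norm_sum_le_variation[OF singleton_decomposition, of x] by (simp add: norm_sum_def norm_abs)

private lemma variation_le_norm: "variation x \<le> K * norm x" for x :: 'a
  by (intro variation_least norm_sum_le_norm)

private lemma variation_abs: "variation \<bar>x\<bar> = variation x" for x :: 'a
  by (simp add: variation_def decompositions_def)

private lemma variation_add:
  fixes f g :: 'a
  assumes "0 \<le> f" "0 \<le> g"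
  shows "variation (f + g) = variation f + variation g"
proof (rule antisym)
  show "variation (f + g) \<le> variation f + variation g"
  proof (rule variation_least)
    fix ks assume "ks \<in> decompositions (f + g)"
    then have "\<forall>k\<in>set ks. 0 \<le> k" "sum_list ks = f + g"
      using assms by (auto simp: decompositions_def abs_of_nonneg)
    with riesz_split[OF assms] obtain fs gs where
      "fs \<in> decompositions f" "gs \<in> decompositions g" "norm_sum ks \<le> norm_sum fs + norm_sum gs"
      by blast
    then show "norm_sum ks \<le> variation f + variation g"
      using norm_sum_le_variation[of fs f] norm_sum_le_variation[of gs g] by linarith
  qed
  have *: "norm_sum fs + norm_sum gs \<le> variation (f + g)"
    if "fs \<in> decompositions f" "gs \<in> decompositions g" for fs gs
  proof -
    have "fs @ gs \<in> decompositions (f + g)"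
      using that assms by (auto simp: decompositions_def abs_of_nonneg)
    then show ?thesis
      using norm_sum_le_variation by (fastforce simp: norm_sum_append)
  qed
  have "variation f \<le> variation (f + g) - norm_sum gs" if "gs \<in> decompositions g" for gs
    using *[OF _ that] by (intro variation_least) (simp add: algebra_simps)
  then have "variation g \<le> variation (f + g) - variation f"
    by (intro variation_least) (simp add: algebra_simps)
  then show "variation f + variation g \<le> variation (f + g)"
    by simp
qed

private lemma variation_nonneg: "0 \<le> variation x" for x :: 'a
  using norm_le_variation[of x] norm_ge_zero[of x] by linarith

private lemma variation_mono:
  fixes x y :: 'a
  assumes "\<bar>x\<bar> \<le> \<bar>y\<bar>"
  shows "variation x \<le> variation y"
proof -
  have "variation \<bar>y\<bar> = variation \<bar>x\<bar> + variation (\<bar>y\<bar> - \<bar>x\<bar>)"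
    using variation_add[of "\<bar>x\<bar>" "\<bar>y\<bar> - \<bar>x\<bar>"] assms by simp
  then show ?thesis
    using variation_nonneg[of "\<bar>y\<bar> - \<bar>x\<bar>"] by (simp add: variation_abs)
qed

private lemma variation_triangle: "variation (x + y) \<le> variation x + variation y" for x y :: 'a
proof -
  have "variation (x + y) \<le> variation (\<bar>x\<bar> + \<bar>y\<bar>)"
    by (rule variation_mono) (simp add: abs_triangle_ineq abs_of_nonneg)
  then show ?thesis
    by (simp add: variation_add variation_abs)
qed

private lemma variation_scaleR_ge: "\<bar>a\<bar> * variation x \<le> variation (a *\<^sub>R x)" for x :: 'a
proof (cases "a = 0")
  case True
  then show ?thesis by (simp add: variation_nonneg)
next
  case False
  have "\<bar>x\<bar> \<le> \<bar>1/a\<bar> *\<^sub>R \<bar>a *\<^sub>R x\<bar>"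
    using abs_scaleR_le[of "1/a" "a *\<^sub>R x"] False by simp
  then have "\<bar>a\<bar> *\<^sub>R \<bar>x\<bar> \<le> \<bar>a\<bar> *\<^sub>R (\<bar>1/a\<bar> *\<^sub>R \<bar>a *\<^sub>R x\<bar>)"
    by (rule scaleR_left_mono) simp
  then have "\<bar>a\<bar> *\<^sub>R \<bar>x\<bar> \<le> \<bar>a *\<^sub>R x\<bar>"
    using False by simp
  with abs_scaleR_le[of a x] have eq: "\<bar>a *\<^sub>R x\<bar> = \<bar>a\<bar> *\<^sub>R \<bar>x\<bar>"
    by (rule antisym)
  have "norm_sum fs \<le> variation (a *\<^sub>R x) / \<bar>a\<bar>" if "fs \<in> decompositions x" for fs
  proof -
    have "map ((*\<^sub>R) \<bar>a\<bar>) fs \<in> decompositions (a *\<^sub>R x)"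
      using that by (auto simp: decompositions_def sum_list_scaleR eq intro: scaleR_nonneg_nonneg)
    then have "\<bar>a\<bar> * norm_sum fs \<le> variation (a *\<^sub>R x)"
      using norm_sum_le_variation by (fastforce simp: norm_sum_scaleR)
    then show ?thesis
      using False by (simp add: field_simps)
  qed
  then have "variation x \<le> variation (a *\<^sub>R x) / \<bar>a\<bar>"
    by (rule variation_least)
  then show ?thesis
    using False by (simp add: field_simps)
qed

private lemma variation_scaleR: "variation (a *\<^sub>R x) = \<bar>a\<bar> * variation x" for x :: 'a
proof (cases "a = 0")
  case True
  then show ?thesis
    using variation_le_norm[of 0] variation_nonneg[of 0] by simp
next
  case False
  then have "variation (a *\<^sub>R x) \<le> \<bar>a\<bar> * variation x"
    using variation_scaleR_ge[of "1/a" "a *\<^sub>R x"] by (simp add: field_simps)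
  with variation_scaleR_ge[of a x] show ?thesis
    by simp
qed

private lemma complete_variation: "complete_norm (variation :: 'a \<Rightarrow> real)"
  unfolding complete_norm_def
proof (intro allI impI)
  fix X :: "nat \<Rightarrow> 'a"
  assume "\<forall>e>0. \<exists>M. \<forall>m\<ge>M. \<forall>n\<ge>M. variation (X m - X n) < e"
  then have "Cauchy X"
    unfolding Cauchy_iff by (meson le_less_trans norm_le_variation)
  then obtain L where "X \<longlonglongrightarrow> L"
    by (auto simp: Cauchy_convergent_iff convergent_def)
  then have lim: "(\<lambda>n. K * norm (X n - L)) \<longlonglongrightarrow> 0"
    by (intro tendsto_mult_right_zero tendsto_norm_zero) (rule LIM_zero)
  have "(\<lambda>n. variation (X n - L)) \<longlonglongrightarrow> 0"
    by (rule tendsto_sandwich[OF _ _ tendsto_const lim])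
      (simp_all add: variation_nonneg variation_le_norm)
  then show "\<exists>L. (\<lambda>n. variation (X n - L)) \<longlonglongrightarrow> 0" ..
qed

text \<open>The new norm is \<^const>\<open>variation\<close>: singleton decompositions give
  \<open>norm \<le> variation\<close>, the bound on norm sums gives \<open>variation \<le> K * norm\<close>, and additivity on
  the cone is the Riesz decomposition property. Since \<open>K\<close> need not be positive when the space is
  trivial, the upper constant is \<open>max K 1\<close>.\<close>

lemma AL_renorming: "\<exists>p :: 'a \<Rightarrow> real. equivalent_norms norm p \<and> AL_norm p"
proof (intro exI conjI)
  have "variation x \<le> max K 1 * norm x" for x :: 'a
    using variation_le_norm[of x] mult_right_mono[of K "max K 1" "norm x"] by simp
  then show "equivalent_norms norm (variation :: 'a \<Rightarrow> real)"
    unfolding equivalent_norms_def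
    by (intro exI[of _ 1] conjI exI[of _ "max K 1"]) (auto simp: norm_le_variation)
  have "variation x = 0 \<longleftrightarrow> x = 0" for x :: 'a
    using norm_le_variation[of x] variation_le_norm[of x] variation_nonneg[of x] by auto
  then show "AL_norm (variation :: 'a \<Rightarrow> real)"
    by (simp add: AL_norm_def banach_lattice_norm_def is_norm_def variation_nonneg variation_scaleR
        variation_triangle complete_variation variation_mono variation_add)
qed

end

section \<open>Consequences of a lower bound\<close>

lemma lower_bound_scaled:
  fixes T :: "real \<Rightarrow> 'a::banach_lattice \<Rightarrow>\<^sub>L 'a"
  assumes "lower_bound J T h" "0 \<le> f"
  shows "((\<lambda>t. norm (neg_part (T t f - norm f *\<^sub>R h))) \<longlongrightarrow> 0) (inf at_top (principal J))"
proof (cases "f = 0")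
  case True
  then show ?thesis
    by (simp add: neg_part_def blinfun.zero_right)
next
  case False
  define g where "g = f /\<^sub>R norm f"
  have "0 \<le> g" "norm g = 1"
    using False assms(2) by (auto simp: g_def intro: scaleR_nonneg_nonneg)
  then have "((\<lambda>t. norm (neg_part (T t g - h))) \<longlongrightarrow> 0) (inf at_top (principal J))"
    using assms(1) by (simp add: lower_bound_def)
  then have lim: "((\<lambda>t. norm f * norm (neg_part (T t g - h))) \<longlongrightarrow> 0) (inf at_top (principal J))"
    by (rule tendsto_mult_right_zero)
  have "norm (neg_part (T t f - norm f *\<^sub>R h)) \<le> norm f * norm (neg_part (T t g - h))" for t
  proof -
    have "T t f - norm f *\<^sub>R h = norm f *\<^sub>R (T t g - h)"
      using False by (simp add: g_def blinfun.scaleR_right scaleR_diff_right)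
    then have "neg_part (T t f - norm f *\<^sub>R h) \<le> norm f *\<^sub>R neg_part (T t g - h)"
      using neg_part_scaleR_le[of "norm f" "T t g - h"] by simp
    then show ?thesis
      using norm_mono_nonneg[OF neg_part_nonneg] by fastforce
  qed
  then show ?thesis
    by (intro tendsto_sandwich[OF _ _ tendsto_const lim]) simp_all
qed

text \<open>The errors of the single summands add up to a bound for the error of the sum, because the
  negative part is subadditive; this turns the lower bound, which concerns one vector at a time,
  into a statement about \<^const>\<open>norm_sum\<close>.\<close>

lemma lower_bound_sum_list:
  fixes T :: "real \<Rightarrow> 'a::banach_lattice \<Rightarrow>\<^sub>L 'a"
  assumes "lower_bound J T h" "\<forall>f\<in>set fs. 0 \<le> f"
  shows "((\<lambda>t. norm (neg_part (T t (sum_list fs) - norm_sum fs *\<^sub>R h))) \<longlongrightarrow> 0)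
    (inf at_top (principal J))"
  using assms(2)
proof (induction fs)
  case Nil
  then show ?case
    by (simp add: neg_part_def norm_sum_def blinfun.zero_right)
next
  case (Cons f fs)
  let ?u = "\<lambda>t. T t f - norm f *\<^sub>R h"
  let ?v = "\<lambda>t. T t (sum_list fs) - norm_sum fs *\<^sub>R h"
  have lim: "((\<lambda>t. norm (neg_part (?u t)) + norm (neg_part (?v t))) \<longlongrightarrow> 0)
      (inf at_top (principal J))"
    using Cons lower_bound_scaled[OF assms(1)] by (intro tendsto_add_zero) auto
  have "norm (neg_part (T t (sum_list (f # fs)) - norm_sum (f # fs) *\<^sub>R h))
      \<le> norm (neg_part (?u t)) + norm (neg_part (?v t))" for t
  proof -
    have "T t (sum_list (f # fs)) - norm_sum (f # fs) *\<^sub>R h = ?u t + ?v t"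
      by (simp add: norm_sum_def blinfun.add_right algebra_simps)
    then have "norm (neg_part (T t (sum_list (f # fs)) - norm_sum (f # fs) *\<^sub>R h))
        \<le> norm (neg_part (?u t) + neg_part (?v t))"
      using norm_mono_nonneg[OF neg_part_nonneg neg_part_add_le] by simp
    also have "\<dots> \<le> norm (neg_part (?u t)) + norm (neg_part (?v t))"
      by (rule norm_triangle_ineq)
    finally show ?thesis .
  qed
  then show ?case
    by (intro tendsto_sandwich[OF _ _ tendsto_const lim]) simp_all
qed

text \<open>For each time \<open>t\<close> the vector \<open>norm_sum fs *\<^sub>R h\<close> lies between \<open>0\<close> and
  \<open>T t (sum_list fs)\<close> plus a vanishing error, so its norm is controlled by \<open>M\<close>; this is where
  boundedness of the operators enters.\<close>

lemma norm_sum_bound_of_lower_bound: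
  fixes T :: "real \<Rightarrow> 'a::banach_lattice \<Rightarrow>\<^sub>L 'a"
    and fs :: "'a list"
  assumes nontrivial: "inf at_top (principal J) \<noteq> bot"
    and M: "\<And>t. t \<in> J \<Longrightarrow> norm (T t) \<le> M"
    and h: "lower_bound J T h"
    and fs: "\<forall>f\<in>set fs. 0 \<le> f"
  shows "norm_sum fs * norm h \<le> M * norm (sum_list fs)"
proof -
  let ?f = "sum_list fs"
  let ?r = "\<lambda>t. neg_part (T t ?f - norm_sum fs *\<^sub>R h)"
  have "norm_sum fs * norm h \<le> M * norm ?f + norm (?r t)" if "t \<in> J" for t
  proof -
    have "norm_sum fs *\<^sub>R h - T t ?f \<le> ?r t"
      by (simp add: neg_part_def)
    then have "norm_sum fs *\<^sub>R h \<le> T t ?f + ?r t"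
      by (simp add: algebra_simps)
    moreover have "0 \<le> norm_sum fs *\<^sub>R h"
      using h by (intro scaleR_nonneg_nonneg norm_sum_nonneg) (simp add: lower_bound_def)
    ultimately have "norm (norm_sum fs *\<^sub>R h) \<le> norm (T t ?f + ?r t)"
      by (intro norm_mono_nonneg)
    also have "\<dots> \<le> norm (T t ?f) + norm (?r t)"
      by (rule norm_triangle_ineq)
    also have "norm (T t ?f) \<le> norm (T t) * norm ?f"
      by (rule norm_blinfun)
    also have "\<dots> \<le> M * norm ?f"
      using M[OF that] by (rule mult_right_mono) simp
    finally show ?thesis
      by (simp add: norm_sum_nonneg)
  qed
  then have "\<forall>\<^sub>F t in inf at_top (principal J). norm_sum fs * norm h \<le> M * norm ?f + norm (?r t)"
    by (simp add: eventually_inf_principal)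
  moreover have "((\<lambda>t. M * norm ?f + norm (?r t)) \<longlongrightarrow> M * norm ?f + 0)
      (inf at_top (principal J))"
    by (intro tendsto_add tendsto_const lower_bound_sum_list h fs)
  ultimately show ?thesis
    using tendsto_lowerbound nontrivial by fastforce
qed

text \<open>Both time sets contain all positive integers, hence are unbounded; the limit in the
  definition of a lower bound is therefore not vacuous.\<close>

lemma time_filter_nontrivial:
  fixes J :: "real set"
  assumes "J = \<nat> - {0} \<or> J = {0<..}"
  shows "inf at_top (principal J) \<noteq> bot"
proof
  assume "inf at_top (principal J) = bot"
  then have "\<forall>\<^sub>F t in at_top. t \<notin> J"
    by (simp add: trivial_limit_def eventually_inf_principal)
  then obtain B where B: "\<And>t. B \<le> t \<Longrightarrow> t \<notin> J"
    by (auto simp: eventually_at_top_linorder)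
  obtain n where "B \<le> real n"
    using real_arch_simple by blast
  then have "real (Suc n) \<notin> J"
    by (intro B) simp
  with assms show False
    by (auto simp del: of_nat_Suc)
qed

theorem theorem3p7:
  fixes T :: "real \<Rightarrow> 'a::banach_lattice \<Rightarrow>\<^sub>L 'a"
    and J :: "real set"
    and h :: 'a
  assumes "J = \<nat> - {0} \<or> J = {0<..}"
    and "semigroup_on J T"
    and "bounded (T ` J)"
    and "\<And>t. t \<in> J \<Longrightarrow> positive_operator (T t)"
    and "lower_bound J T h"
    and "h \<noteq> 0"
  shows "\<exists>p :: 'a \<Rightarrow> real. equivalent_norms norm p \<and> AL_norm p"
proof -
  obtain M where M: "\<And>t. t \<in> J \<Longrightarrow> norm (T t) \<le> M"
    using assms(3) by (auto simp: bounded_iff)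
  show ?thesis
  proof (rule AL_renorming[of "M / norm h"])
    fix fs :: "'a list"
    assume fs: "\<forall>f\<in>set fs. 0 \<le> f"
    have "norm_sum fs * norm h \<le> M * norm (sum_list fs)"
      by (rule norm_sum_bound_of_lower_bound[OF time_filter_nontrivial[OF assms(1)] M assms(5) fs])
    then show "norm_sum fs \<le> M / norm h * norm (sum_list fs)"
      using assms(6) by (simp add: field_simps)
  qed
qed

end
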